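(* Let $k\geq 1$ and $\ell\geq s\geq r\geq 3$ be integers. Then as $n\to\infty$, $$\mathrm{ex}_r(n,K_s^{(r)},kK_{\ell+1}^r)=(1+o(1))\,\mathcal{N}\big(K_s^{(r)},S_{n,k-1}^r(n-k+1,\ell)\big).$$
   Context: An $r$-graph is a hypergraph all of whose hyperedges have exactly $r$ vertices. $K_s^{(r)}$ is the complete $r$-graph on $s$ vertices. For a graph $F$, the $r$-expansion $F^r$ is obtained from $F$ by adding $r-2$ new vertices to each edge, all new vertices distinct from each other and from $V(F)$; $K_{\ell+1}^r$ is the $r$-expansion of $K_{\ell+1}$, and $kK_{\ell+1}^r$ is the vertex-disjoint union of $k$ copies of it. $\mathcal{T}_r(m,\ell)$ is the complete balanced $\ell$-partite $r$-graph on $m$ vertices (parts of sizes differing by at most one, hyperedges all $r$-sets meeting each part in at most one vertex). $S_{n,t}^r(n-t,\ell)$ is the $n$-vertex $r$-graph obtained by taking a set $U$ of $t$ vertices and a vertex-disjoint copy of $\mathcal{T}_r(n-t,\ell)$, and adding as hyperedges all $r$-sets containing at least one vertex of $U$. $\mathcal{N}(\mathcal{G}_1,\mathcal{G}_2)$ is the number of copies of $\mathcal{G}_1$ in $\mathcal{G}_2$. $\mathrm{ex}_r(n,\mathcal{H},\mathcal{F})$ is the maximum number of copies of $\mathcal{H}$ in an $n$-vertex $r$-graph containing no copy of $\mathcal{F}$. *)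

theory Defs
  imports Complex_Main "HOL-Library.Landau_Symbols"
begin

type_synonym 'a hgraph = "'a set \<times> 'a set set"

abbreviation verts :: "'a hgraph \<Rightarrow> 'a set" where "verts G \<equiv> fst G"
abbreviation edges :: "'a hgraph \<Rightarrow> 'a set set" where "edges G \<equiv> snd G"

definition r_graph :: "nat \<Rightarrow> 'a hgraph \<Rightarrow> bool" where
  "r_graph r G \<longleftrightarrow> finite (verts G) \<and> (\<forall>e\<in>edges G. e \<subseteq> verts G \<and> card e = r)"

definition hgraph_iso :: "'a hgraph \<Rightarrow> 'b hgraph \<Rightarrow> bool" where
  "hgraph_iso F H \<longleftrightarrow>
     (\<exists>f. bij_betw f (verts F) (verts H) \<and> edges H = (\<lambda>e. f ` e) ` edges F)"

text \<open>Copies are (not necessarily induced) subhypergraphs, so they are counted without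
  multiplicity from automorphisms.\<close>

definition copies :: "'a hgraph \<Rightarrow> 'b hgraph \<Rightarrow> 'b hgraph set" where
  "copies F G = {H. verts H \<subseteq> verts G \<and> edges H \<subseteq> edges G \<and> hgraph_iso F H}"

definition num_copies :: "'a hgraph \<Rightarrow> 'b hgraph \<Rightarrow> nat" where
  "num_copies F G = card (copies F G)"

definition complete_hgraph :: "nat \<Rightarrow> nat \<Rightarrow> nat hgraph" where
  "complete_hgraph r s = ({..<s}, {e. e \<subseteq> {..<s} \<and> card e = r})"

text \<open>In the expansion of a graph, \<open>Inl v\<close> is an old vertex and \<open>Inr (e, i)\<close> is the \<open>i\<close>-th new
  vertex added to the edge \<open>e\<close>.\<close>

definition expansion :: "nat \<Rightarrow> 'a hgraph \<Rightarrow> ('a + 'a set \<times> nat) hgraph" where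
  "expansion r F =
     (Inl ` verts F \<union> Inr ` (edges F \<times> {..<r - 2}),
      (\<lambda>e. Inl ` e \<union> Inr ` ({e} \<times> {..<r - 2})) ` edges F)"

definition disjoint_copies :: "nat \<Rightarrow> 'a hgraph \<Rightarrow> (nat \<times> 'a) hgraph" where
  "disjoint_copies k F =
     ({..<k} \<times> verts F, {Pair i ` e | i e. i < k \<and> e \<in> edges F})"

text \<open>The parts are the residue classes modulo \<open>l\<close> in \<open>{..<m}\<close>.\<close>

definition balanced_partite :: "nat \<Rightarrow> nat \<Rightarrow> nat \<Rightarrow> nat hgraph" where
  "balanced_partite r m l =
     ({..<m},
      {e. e \<subseteq> {..<m} \<and> card e = r \<and> (\<forall>j<l. card (e \<inter> {v. v mod l = j}) \<le> 1)})"

text \<open>The \<open>n\<close>-vertex hypergraph in which \<open>U = {n - t..<n}\<close>.\<close>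

definition joined_partite :: "nat \<Rightarrow> nat \<Rightarrow> nat \<Rightarrow> nat \<Rightarrow> nat hgraph" where
  "joined_partite r n t l =
     ({..<n},
      edges (balanced_partite r (n - t) l) \<union>
      {e. e \<subseteq> {..<n} \<and> card e = r \<and> e \<inter> {n - t..<n} \<noteq> {}})"

text \<open>As hypergraphs are considered up to isomorphism, it is enough to let the vertices be natural
  numbers.\<close>

definition ex_count :: "nat \<Rightarrow> nat \<Rightarrow> 'a hgraph \<Rightarrow> 'b hgraph \<Rightarrow> nat" where
  "ex_count r n H F =
     Max {num_copies H G | G :: nat hgraph.
            r_graph r G \<and> card (verts G) = n \<and> copies F G = {}}"

lemma balanced_partite_parts:
  assumes "l > 0"
  shows "verts (balanced_partite r m l) = (\<Union>j<l. {v. v < m \<and> v mod l = j})"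
    and "i < l \<Longrightarrow> j < l \<Longrightarrow>
           card {v. v < m \<and> v mod l = i} \<le> card {v. v < m \<and> v mod l = j} + 1"
proof -
  show "verts (balanced_partite r m l) = (\<Union>j<l. {v. v < m \<and> v mod l = j})"
    using assms by (auto simp: balanced_partite_def)
next
  assume i: "i < l" and j: "j < l"
  let ?A = "{v. v < m \<and> v mod l = i}" and ?B = "{v. v < m \<and> v mod l = j}"
  have inj: "inj_on (\<lambda>v. v div l) ?A"
    by (rule inj_onI) (metis (mono_tags, lifting) div_mult_mod_eq mem_Collect_eq)
  have "(\<lambda>v. v div l) ` ?A \<subseteq> insert 0 ((\<lambda>v. Suc (v div l)) ` ?B)"
  proof
    fix q assume "q \<in> (\<lambda>v. v div l) ` ?A"
    then obtain v where v: "v < m" "v mod l = i" "q = v div l" by auto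
    show "q \<in> insert 0 ((\<lambda>v. Suc (v div l)) ` ?B)"
    proof (cases q)
      case (Suc p)
      have "v = q * l + i" using v by (metis div_mult_mod_eq)
      then have "p * l + j < m" using v(1) Suc j by simp
      then have "p * l + j \<in> ?B" using j by simp
      moreover have "q = Suc ((p * l + j) div l)" using Suc j by simp
      ultimately show ?thesis by blast
    qed simp
  qed
  then have "card ((\<lambda>v. v div l) ` ?A) \<le> card (insert 0 ((\<lambda>v. Suc (v div l)) ` ?B))"
    by (intro card_mono) auto
  also have "\<dots> \<le> Suc (card ((\<lambda>v. Suc (v div l)) ` ?B))"
    by (rule card_insert_le_m1) auto
  also have "\<dots> \<le> Suc (card ?B)" by (simp add: card_image_le)
  finally show "card ?A \<le> card ?B + 1" using card_image[OF inj] by simp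
qed

lemma r_graph_joined_partite: "r_graph r (joined_partite r n t l)"
  by (fastforce simp: r_graph_def joined_partite_def balanced_partite_def)

lemma ex_count_finite:
  "finite {num_copies H G | G :: nat hgraph.
            r_graph r G \<and> card (verts G) = n \<and> copies F G = {}}"
proof (rule finite_subset)
  show "{num_copies H G | G :: nat hgraph.
            r_graph r G \<and> card (verts G) = n \<and> copies F G = {}} \<subseteq> {..2 ^ n * 2 ^ (2 ^ n)}"
  proof (clarsimp simp del: split_paired_All)
    fix V :: "nat set" and E
    assume G: "r_graph r (V, E)" and n: "n = card V"
    have fin: "finite V" and E: "E \<subseteq> Pow V" using G by (auto simp: r_graph_def)
    have "copies H (V, E) \<subseteq> Pow V \<times> Pow (Pow V)" using E by (fastforce simp: copies_def)
    then have "card (copies H (V, E)) \<le> card (Pow V \<times> Pow (Pow V))"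
      using fin by (intro card_mono) auto
    then show "num_copies H (V, E) \<le> 2 ^ card V * 2 ^ 2 ^ card V"
      using fin by (simp add: num_copies_def card_cartesian_product card_Pow)
  qed
qed auto

end

theory Submission
  imports Defs "HOL-Analysis.Convex" "HOL-Library.FuncSet" "HOL-Library.Disjoint_Sets"
begin

text \<open>Call a pair of vertices heavy if no set of \<open>t\<close> further vertices meets all hyperedges through
  the pair, where \<open>t\<close> is a constant at least the number of vertices of the forbidden hypergraph.
  A complete set containing a light pair also contains one of the at most \<open>t\<close> vertices that meet all
  hyperedges through the pair, so there are only \<open>O(n\<^sup>s\<^sup>-\<^sup>1)\<close> such sets; all other complete sets
  are \<open>s\<close>-cliques of the graph of heavy pairs. This graph has no \<open>k\<close> disjoint \<open>(l + 1)\<close>-cliques, since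
  these could be expanded greedily, edge by edge, to a copy of the forbidden hypergraph. Hence
  deleting boundedly many vertices leaves a graph without \<open>(l + 1)\<close>-cliques, which by Zykov's theorem
  has at most \<open>(l choose s) (n / l)\<^sup>s\<close> cliques of size \<open>s\<close>. The extremal construction attains this
  up to lower order terms, and it is free of the forbidden hypergraph because every expanded
  \<open>(l + 1)\<close>-clique uses one of the \<open>k - 1\<close> special vertices.\<close>

section \<open>Cliques of graphs without large cliques\<close>

definition cliques :: "'a set \<Rightarrow> ('a \<Rightarrow> 'a \<Rightarrow> bool) \<Rightarrow> nat \<Rightarrow> 'a set set" where
  "cliques V R s = {A. A \<subseteq> V \<and> card A = s \<and> (\<forall>u\<in>A. \<forall>v\<in>A. u \<noteq> v \<longrightarrow> R u v)}"

text \<open>For a clique \<open>A\<close> these are the common neighbours of \<open>A\<close>, and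
  their number plays the role of the degree of \<open>A\<close>.\<close>

definition clique_ext :: "'a set \<Rightarrow> ('a \<Rightarrow> 'a \<Rightarrow> bool) \<Rightarrow> 'a set \<Rightarrow> 'a set" where
  "clique_ext V R A = {v \<in> V - A. insert v A \<in> cliques V R (Suc (card A))}"

lemma finite_cliques: "finite V \<Longrightarrow> finite (cliques V R s)"
  by (rule finite_subset[of _ "Pow V"]) (auto simp: cliques_def)

lemma finite_clique_ext: "finite V \<Longrightarrow> finite (clique_ext V R A)"
  by (simp add: clique_ext_def)

lemma cliques_0: "finite V \<Longrightarrow> cliques V R 0 = {{}}"
  by (auto simp: cliques_def dest: finite_subset)

lemma clique_remove: "finite V \<Longrightarrow> A \<in> cliques V R (Suc j) \<Longrightarrow> a \<in> A \<Longrightarrow> A - {a} \<in> cliques V R j"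
  by (auto simp: cliques_def)

lemma clique_cardD: "A \<in> cliques V R j \<Longrightarrow> card A = j"
  by (simp add: cliques_def)

lemma cliqueD: "A \<in> cliques V R j \<Longrightarrow> x \<in> A \<Longrightarrow> y \<in> A \<Longrightarrow> x \<noteq> y \<Longrightarrow> R x y"
  by (simp add: cliques_def)

lemma clique_finite: "finite V \<Longrightarrow> A \<in> cliques V R j \<Longrightarrow> finite A"
  by (auto simp: cliques_def dest: finite_subset)

text \<open>Double counting: a clique \<open>A\<close> with a marked element \<open>a\<close>
  corresponds to the clique \<open>A - {a}\<close> with a marked extension \<open>a\<close>.
  Constant weight gives a handshake identity; taking \<open>g\<close> to be the degree turns a sum
  of squared degrees of \<open>j\<close>-cliques into a sum over the next larger cliques.\<close>

lemma sum_cliques_Suc: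
  fixes g :: "'a set \<Rightarrow> real"
  assumes V: "finite V"
  shows "(\<Sum>A\<in>cliques V R (Suc j). \<Sum>a\<in>A. g (A - {a})) =
         (\<Sum>C\<in>cliques V R j. real (card (clique_ext V R C)) * g C)"
proof -
  have "(\<Sum>A\<in>cliques V R (Suc j). \<Sum>a\<in>A. g (A - {a})) =
        (\<Sum>(A, a)\<in>(SIGMA A:cliques V R (Suc j). A). g (A - {a}))"
    using V by (intro sum.Sigma) (auto intro: finite_cliques clique_finite)
  also have "\<dots> = (\<Sum>(C, v)\<in>(SIGMA C:cliques V R j. clique_ext V R C). g C)"
  proof (rule sum.reindex_bij_witness[where i = "\<lambda>(C, v). (insert v C, v)"
        and j = "\<lambda>(A, a). (A - {a}, a)"])
    fix p assume "p \<in> (SIGMA A:cliques V R (Suc j). A)"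
    then obtain A a where p: "p = (A, a)" "A \<in> cliques V R (Suc j)" "a \<in> A" by auto
    have "A - {a} \<in> cliques V R j" by (rule clique_remove[OF V p(2,3)])
    moreover have "a \<in> clique_ext V R (A - {a})"
      using p clique_cardD[OF calculation] by (auto simp: clique_ext_def insert_absorb cliques_def)
    ultimately show "(\<lambda>(A, a). (A - {a}, a)) p \<in> (SIGMA C:cliques V R j. clique_ext V R C)"
      using p by simp
  qed (auto simp: clique_ext_def cliques_def)
  also have "\<dots> = (\<Sum>C\<in>cliques V R j. \<Sum>v\<in>clique_ext V R C. g C)"
    using V by (intro sum.Sigma[symmetric]) (auto intro: finite_cliques finite_clique_ext)
  finally show ?thesis by simp
qed

lemma sum_card_clique_ext:
  assumes "finite V"
  shows "(\<Sum>C\<in>cliques V R j. real (card (clique_ext V R C))) =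
         real (Suc j) * real (card (cliques V R (Suc j)))"
proof -
  have "(\<Sum>C\<in>cliques V R j. real (card (clique_ext V R C))) =
        (\<Sum>A\<in>cliques V R (Suc j). real (card A))"
    using sum_cliques_Suc[OF assms, where g = "\<lambda>_. 1"] by simp
  also have "\<dots> = real (Suc j) * real (card (cliques V R (Suc j)))"
    by (simp add: clique_cardD)
  finally show ?thesis .
qed

text \<open>After exchanging the sums, each vertex \<open>v\<close> is charged for the
  \<open>a\<close> in \<open>A\<close> such that \<open>v\<close> extends \<open>A - {a}\<close>.
  There are at most \<open>j + 1\<close> of these, and at most one unless \<open>v\<close> extends
  the whole of \<open>A\<close>.\<close>

lemma sum_card_clique_ext_remove_le:
  assumes V: "finite V" and A: "A \<in> cliques V R (Suc j)"
  shows "(\<Sum>a\<in>A. card (clique_ext V R (A - {a}))) \<le> card V + j * card (clique_ext V R A)"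
proof -
  have fA: "finite A" by (rule clique_finite[OF V A])
  have AV: "A \<subseteq> V" and cA: "card A = Suc j" using A by (auto simp: cliques_def)
  let ?S = "\<lambda>v. {a \<in> A. v \<in> clique_ext V R (A - {a})}"
  have "(\<Sum>a\<in>A. card (clique_ext V R (A - {a}))) =
        (\<Sum>a\<in>A. \<Sum>v\<in>V. if v \<in> clique_ext V R (A - {a}) then 1 else 0)"
  proof (rule sum.cong[OF refl])
    fix a assume "a \<in> A"
    have "clique_ext V R (A - {a}) = {v \<in> V. v \<in> clique_ext V R (A - {a})}"
      by (auto simp: clique_ext_def)
    then show "card (clique_ext V R (A - {a})) =
        (\<Sum>v\<in>V. if v \<in> clique_ext V R (A - {a}) then 1 else 0)"
      using V by (simp add: sum.If_cases Int_def)
  qed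
  also have "\<dots> = (\<Sum>v\<in>V. \<Sum>a\<in>A. if v \<in> clique_ext V R (A - {a}) then 1 else 0)"
    by (rule sum.swap)
  also have "\<dots> = (\<Sum>v\<in>V. card (?S v))"
    using fA by (simp add: sum.If_cases Int_def)
  also have "\<dots> \<le> (\<Sum>v\<in>V. 1 + (if v \<in> clique_ext V R A then j else 0))"
  proof (rule sum_mono)
    fix v assume v: "v \<in> V"
    have le: "card (?S v) \<le> Suc j"
      using card_mono[OF fA, of "?S v"] cA by auto
    show "card (?S v) \<le> 1 + (if v \<in> clique_ext V R A then j else 0)"
    proof (cases "v \<in> clique_ext V R A")
      case False
      \<comment> \<open>A vertex outside \<open>A\<close> that extends two of the sets \<open>A - {a}\<close> extends \<open>A\<close> itself.\<close>
      have "a = b" if a: "a \<in> ?S v" and b: "b \<in> ?S v" for a b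
      proof (rule ccontr)
        assume ne: "a \<noteq> b"
        \<comment> \<open>If \<open>v\<close> were in \<open>A\<close>, extending
          \<open>A - {a}\<close> would force \<open>v = a\<close> and extending
          \<open>A - {b}\<close> would force \<open>v = b\<close>.\<close>
        have vA: "v \<notin> A" using a b ne by (auto simp: clique_ext_def)
        have "insert v (A - {c}) \<in> cliques V R (Suc j)" if "c \<in> ?S v" for c
        proof -
          have "card (A - {c}) = j" using that cA by auto
          moreover have "insert v (A - {c}) \<in> cliques V R (Suc (card (A - {c})))"
            using that unfolding clique_ext_def by blast
          ultimately show ?thesis by (simp only:)
        qed
        then have cl: "R x y" if "c \<in> ?S v" "x \<in> insert v (A - {c})" "y \<in> insert v (A - {c})" "x \<noteq> y"
          for x y c
          using that by (meson cliqueD)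
        have "R x y" if "x \<in> insert v A" "y \<in> insert v A" "x \<noteq> y" for x y
        proof (cases "x \<in> A \<and> y \<in> A")
          case True
          then show ?thesis using A that(3) by (simp add: cliques_def)
        next
          case False
          \<comment> \<open>At least one of \<open>x\<close>, \<open>y\<close> is \<open>v\<close>,
            which differs from \<open>a\<close> and \<open>b\<close>; the other cannot equal both.
            So one of the two cliques obtained from \<open>a\<close> and \<open>b\<close> contains
            both \<open>x\<close> and \<open>y\<close>.\<close>
          then have "(x \<noteq> a \<and> y \<noteq> a) \<or> (x \<noteq> b \<and> y \<noteq> b)" using that(1,2) vA ne a b by auto
          then show ?thesis
          proof
            assume "x \<noteq> a \<and> y \<noteq> a"
            then show ?thesis using cl[OF a, of x y] that by simp
          next
            assume "x \<noteq> b \<and> y \<noteq> b"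
            then show ?thesis using cl[OF b, of x y] that by simp
          qed
        qed
        then have "insert v A \<in> cliques V R (Suc (Suc j))"
          using AV v vA fA cA by (simp add: cliques_def)
        then have "v \<in> clique_ext V R A" using v vA cA by (simp add: clique_ext_def)
        then show False using False by simp
      qed
      then have "card (?S v) \<le> 1"
        using fA by (simp add: card_le_Suc0_iff_eq)
      then show ?thesis by simp
    qed (use le in simp)
  qed
  also have "\<dots> = card V + j * card {v \<in> V. v \<in> clique_ext V R A}"
    unfolding sum.distrib using V by (simp add: sum.If_cases Int_def)
  also have "{v \<in> V. v \<in> clique_ext V R A} = clique_ext V R A"
    by (auto simp: clique_ext_def)
  finally show ?thesis .
qed

text \<open>Cauchy-Schwarz for the degrees of the \<open>j\<close>-cliques: their sum is
  \<open>(j + 1) * N (j + 1)\<close>, and the sum of their squares is bounded by adding up the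
  preceding lemma over all \<open>(j + 1)\<close>-cliques. The form without divisions also covers
  vanishing clique numbers.\<close>

theorem Moon_Moser:
  fixes R :: "'a \<Rightarrow> 'a \<Rightarrow> bool"
  assumes V: "finite V"
  defines "N \<equiv> \<lambda>i. real (card (cliques V R i))"
  shows "(real (Suc j) * N (Suc j))\<^sup>2 \<le>
         N j * (real (card V) * N (Suc j) + real j * real (j + 2) * N (Suc (Suc j)))"
proof -
  let ?d = "\<lambda>C. real (card (clique_ext V R C))"
  have "(\<Sum>C\<in>cliques V R j. (?d C)\<^sup>2) = (\<Sum>A\<in>cliques V R (Suc j). \<Sum>a\<in>A. ?d (A - {a}))"
    using sum_cliques_Suc[OF V, where g = ?d] by (simp add: power2_eq_square)
  also have "\<dots> \<le> (\<Sum>A\<in>cliques V R (Suc j). real (card V) + real j * ?d A)"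
  proof (rule sum_mono)
    fix A assume "A \<in> cliques V R (Suc j)"
    from sum_card_clique_ext_remove_le[OF V this]
    have "real (\<Sum>a\<in>A. card (clique_ext V R (A - {a}))) \<le> real (card V + j * card (clique_ext V R A))"
      by (simp only: of_nat_le_iff)
    then show "(\<Sum>a\<in>A. ?d (A - {a})) \<le> real (card V) + real j * ?d A" by simp
  qed
  also have "\<dots> = real (card V) * N (Suc j) + real j * (\<Sum>A\<in>cliques V R (Suc j). ?d A)"
    by (simp add: sum.distrib sum_distrib_left N_def)
  also have "\<dots> = real (card V) * N (Suc j) + real j * real (j + 2) * N (Suc (Suc j))"
    unfolding sum_card_clique_ext[OF V] by (simp add: N_def)
  finally have sq: "(\<Sum>C\<in>cliques V R j. (?d C)\<^sup>2) \<le>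
      real (card V) * N (Suc j) + real j * real (j + 2) * N (Suc (Suc j))" .
  have "(real (Suc j) * N (Suc j))\<^sup>2 = (\<Sum>C\<in>cliques V R j. ?d C)\<^sup>2"
    unfolding sum_card_clique_ext[OF V] N_def ..
  also have "\<dots> \<le> (\<Sum>C\<in>cliques V R j. (?d C)\<^sup>2) * N j"
    unfolding N_def by (rule sum_squared_le_sum_of_squares)
  also have "\<dots> \<le> (real (card V) * N (Suc j) + real j * real (j + 2) * N (Suc (Suc j))) * N j"
    using sq by (intro mult_right_mono) (auto simp: N_def)
  finally show ?thesis by (simp add: mult.commute)
qed

text \<open>Downward induction from \<open>j = l\<close>, where the left side vanishes; Moon-Moser
  passes the bound on the ratio of consecutive clique numbers from \<open>i + 1\<close> to
  \<open>i\<close>. The ratio is the one attained by the complete \<open>l\<close>-partite graph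
  with equal parts.\<close>

lemma card_cliques_Suc_le:
  assumes V: "finite V" and free: "cliques V R (Suc l) = {}" and j: "j \<le> l"
  shows "real (Suc j) * real l * real (card (cliques V R (Suc j))) \<le>
         real (l - j) * real (card V) * real (card (cliques V R j))"
  using j
proof (induction rule: inc_induct)
  case base
  then show ?case using free by simp
next
  case (step i)
  define N where "N = (\<lambda>i. real (card (cliques V R i)))"
  define n where "n = real (card V)"
  have nonneg: "0 \<le> N i" for i by (simp add: N_def)
  have IH: "real (i + 2) * real l * N (Suc (Suc i)) \<le> real (l - Suc i) * n * N (Suc i)"
    using step.IH by (simp add: N_def n_def algebra_simps)
  show ?case
  proof (cases "N (Suc i) = 0")
    case True
    then show ?thesis by (simp add: N_def)
  next
    case False
    then have pos: "0 < real (Suc i) * N (Suc i)" using nonneg[of "Suc i"] by simp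
    have MM: "(real (Suc i) * N (Suc i))\<^sup>2 \<le>
         N i * (n * N (Suc i) + real i * real (i + 2) * N (Suc (Suc i)))"
      unfolding N_def n_def by (rule Moon_Moser[OF V])
    have li: "real (l - Suc i) = real l - real i - 1" "real (l - i) = real l - real i"
      using step.hyps by auto
    have "(real (Suc i) * N (Suc i)) * (real (Suc i) * real l * N (Suc i)) =
          real l * (real (Suc i) * N (Suc i))\<^sup>2"
      by (simp add: power2_eq_square)
    also have "\<dots> \<le> real l * (N i * (n * N (Suc i) + real i * real (i + 2) * N (Suc (Suc i))))"
      by (intro mult_left_mono MM) simp
    also have "\<dots> = N i * (real l * n * N (Suc i) + real i * (real (i + 2) * real l * N (Suc (Suc i))))"
      by (simp add: algebra_simps)
    also have "\<dots> \<le> N i * (real l * n * N (Suc i) + real i * (real (l - Suc i) * n * N (Suc i)))"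
      using IH nonneg by (intro mult_left_mono add_left_mono) auto
    \<comment> \<open>The factorisation \<open>l + i * (l - i - 1) = (i + 1) * (l - i)\<close>
      produces the factor that is cancelled next.\<close>
    also have "\<dots> = (real (Suc i) * N (Suc i)) * (real (l - i) * n * N i)"
      unfolding li by (simp add: algebra_simps)
    finally have "real (Suc i) * real l * N (Suc i) \<le> real (l - i) * n * N i"
      using pos by (simp only: mult_le_cancel_left_pos)
    then show ?thesis by (simp add: N_def n_def)
  qed
qed

text \<open>The bounds on consecutive ratios are multiplied, starting from the single empty clique;
  the factors \<open>(l - s) / (s + 1)\<close> build up the binomial coefficient.\<close>

theorem Zykov:
  assumes V: "finite V" and free: "cliques V R (Suc l) = {}" and l: "l > 0" and s: "s \<le> l"
  shows "real (card (cliques V R s)) \<le> real (l choose s) * (real (card V) / real l) ^ s"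
  using s
proof (induction s)
  case 0
  then show ?case using V by (simp add: cliques_0)
next
  case (Suc s)
  let ?N = "\<lambda>i. real (card (cliques V R i))" and ?x = "real (card V) / real l"
  have ch: "real (Suc s) * real (l choose Suc s) = real (l - s) * real (l choose s)"
    using binomial_absorption[of s l] binomial_absorb_comp[of l s]
    by (metis of_nat_mult)
  have "real (Suc s) * ?N (Suc s) \<le> real (l - s) * ?x * ?N s"
    using card_cliques_Suc_le[OF V free, of s] Suc.prems l by (simp add: field_simps)
  also have "\<dots> \<le> real (l - s) * ?x * (real (l choose s) * ?x ^ s)"
    using Suc by (intro mult_left_mono) auto
  also have "\<dots> = real (Suc s) * real (l choose Suc s) * ?x ^ Suc s"
    unfolding ch by simp
  finally have "real (Suc s) * ?N (Suc s) \<le> real (Suc s) * (real (l choose Suc s) * ?x ^ Suc s)"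
    by (simp only: mult.assoc)
  then show ?case by (simp only: mult_le_cancel_left_pos of_nat_0_less_iff zero_less_Suc)
qed

section \<open>Heavy pairs\<close>

definition complete_sets :: "nat \<Rightarrow> 'a hgraph \<Rightarrow> nat \<Rightarrow> 'a set set" where
  "complete_sets r G s =
     {W. W \<subseteq> verts G \<and> card W = s \<and> (\<forall>e. e \<subseteq> W \<longrightarrow> card e = r \<longrightarrow> e \<in> edges G)}"

lemma image_card_subsets:
  assumes "bij_betw f A B"
  shows "(\<lambda>e. f ` e) ` {e. e \<subseteq> A \<and> card e = r} = {e. e \<subseteq> B \<and> card e = r}"
proof (intro equalityI subsetI)
  fix e assume "e \<in> (\<lambda>e. f ` e) ` {e. e \<subseteq> A \<and> card e = r}"
  then obtain e' where "e = f ` e'" "e' \<in> {e. e \<subseteq> A \<and> card e = r}" by (rule imageE)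
  then have e': "e = f ` e'" "e' \<subseteq> A" "card e' = r" by simp_all
  have "card (f ` e') = card e'"
    by (rule card_image[OF inj_on_subset[OF bij_betw_imp_inj_on[OF assms] e'(2)]])
  then show "e \<in> {e. e \<subseteq> B \<and> card e = r}"
    using e' assms by (auto simp: bij_betw_def)
next
  fix e assume e: "e \<in> {e. e \<subseteq> B \<and> card e = r}"
  then obtain e' where e': "e' \<subseteq> A" "e = f ` e'"
    using assms by (metis (mono_tags, lifting) bij_betw_imp_surj_on mem_Collect_eq subset_imageE)
  have "card (f ` e') = card e'"
    by (rule card_image[OF inj_on_subset[OF bij_betw_imp_inj_on[OF assms] e'(1)]])
  then show "e \<in> (\<lambda>e. f ` e) ` {e. e \<subseteq> A \<and> card e = r}"
    using e e' by auto
qed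

text \<open>A copy of a complete hypergraph is determined by its vertex set, so counting copies
  reduces to counting sets and isomorphisms disappear from the rest of the proof.\<close>

lemma num_copies_complete:
  assumes "finite (verts G)"
  shows "num_copies (complete_hgraph r s) G = card (complete_sets r G s)"
proof -
  let ?K = "\<lambda>W. (W, {e. e \<subseteq> W \<and> card e = r})"
  have "copies (complete_hgraph r s) G = ?K ` complete_sets r G s"
  proof (intro equalityI subsetI)
    fix H assume H: "H \<in> copies (complete_hgraph r s) G"
    then obtain f where f: "bij_betw f {..<s} (verts H)"
      and E: "edges H = (\<lambda>e. f ` e) ` {e. e \<subseteq> {..<s} \<and> card e = r}"
      by (auto simp: copies_def hgraph_iso_def complete_hgraph_def)
    have E': "edges H = {e. e \<subseteq> verts H \<and> card e = r}"
      unfolding E by (rule image_card_subsets[OF f])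
    have "card (verts H) = s" using bij_betw_same_card[OF f] by simp
    then have "verts H \<in> complete_sets r G s"
      using H E' by (auto simp: complete_sets_def copies_def)
    moreover have "H = ?K (verts H)" using E' by (metis prod.collapse)
    ultimately show "H \<in> ?K ` complete_sets r G s" by blast
  next
    fix H assume "H \<in> ?K ` complete_sets r G s"
    then obtain W where W: "W \<in> complete_sets r G s" and H: "H = ?K W" by blast
    have fW: "finite W" and cW: "card W = s"
      using W assms by (auto simp: complete_sets_def dest: finite_subset)
    obtain f where f: "bij_betw f {..<s} W"
      using ex_bij_betw_nat_finite[OF fW] unfolding cW atLeast0LessThan by blast
    have "hgraph_iso (complete_hgraph r s) H"
      unfolding hgraph_iso_def H complete_hgraph_def fst_conv snd_conv
      by (intro exI[of _ f] conjI f image_card_subsets[OF f, symmetric])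
    then show "H \<in> copies (complete_hgraph r s) G"
      using W by (auto simp: H copies_def complete_sets_def)
  qed
  moreover have "inj_on ?K (complete_sets r G s)" by (auto simp: inj_on_def)
  ultimately show ?thesis by (simp add: num_copies_def card_image)
qed

lemma finite_complete_sets: "finite (verts G) \<Longrightarrow> finite (complete_sets r G s)"
  by (rule finite_subset[of _ "Pow (verts G)"]) (auto simp: complete_sets_def)

text \<open>Deleting \<open>T\<close> is injective on its supersets, so each prescribed vertex saves
  a factor of the order of \<open>V\<close>.\<close>

lemma card_supersets_le:
  assumes V: "finite V" and T: "finite T"
  shows "card {W. W \<subseteq> V \<and> card W = s \<and> T \<subseteq> W} \<le> card V ^ (s - card T)"
proof -
  have "card {W. W \<subseteq> V \<and> card W = s \<and> T \<subseteq> W} \<le> card {Z. Z \<subseteq> V \<and> card Z = s - card T}"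
  proof (rule card_inj_on_le[where f = "\<lambda>W. W - T"])
    show "inj_on (\<lambda>W. W - T) {W. W \<subseteq> V \<and> card W = s \<and> T \<subseteq> W}"
      by (rule inj_onI) auto
    show "(\<lambda>W. W - T) ` {W. W \<subseteq> V \<and> card W = s \<and> T \<subseteq> W} \<subseteq> {Z. Z \<subseteq> V \<and> card Z = s - card T}"
      using T by (auto simp: card_Diff_subset)
    show "finite {Z. Z \<subseteq> V \<and> card Z = s - card T}"
      using V by simp
  qed
  also have "\<dots> = card V choose (s - card T)" by (rule n_subsets[OF V])
  also have "\<dots> \<le> card V ^ (s - card T)"
    by (cases "s - card T \<le> card V") (auto intro: binomial_le_pow simp: binomial_eq_0)
  finally show ?thesis .
qed

section \<open>Light pairs lie in few complete sets\<close>

definition heavy :: "nat \<Rightarrow> 'a hgraph \<Rightarrow> 'a set \<Rightarrow> bool" where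
  "heavy t G p \<longleftrightarrow>
     (\<forall>X. X \<subseteq> verts G - p \<longrightarrow> card X \<le> t \<longrightarrow> (\<exists>e\<in>edges G. p \<subseteq> e \<and> e \<inter> X = {}))"

text \<open>A complete set with a light pair \<open>u\<close>, \<open>v\<close> contains a third
  vertex from a blocking set of size at most \<open>t\<close>. With \<open>n\<close> vertices this
  leaves \<open>n\<close> choices for each of \<open>u\<close> and \<open>v\<close>,
  \<open>t\<close> for the third vertex and \<open>n ^ (s - 3)\<close> for the rest.\<close>

lemma card_complete_sets_light_le:
  assumes G: "r_graph r G" and r: "3 \<le> r" and s: "r \<le> s"
  shows "card (complete_sets r G s - cliques (verts G) (\<lambda>u v. heavy t G {u, v}) s)
         \<le> t * card (verts G) ^ (s - 1)"
proof -
  define V where "V = verts G"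
  have V: "finite V" using G by (simp add: r_graph_def V_def)
  \<comment> \<open>The existence claim covers all pairs so that blocking sets can be chosen
    simultaneously; for a heavy pair the last conjunct is vacuous and \<open>{}\<close>
    serves.\<close>
  have ex: "\<exists>X. X \<subseteq> V - {u, v} \<and> card X \<le> t \<and>
      (\<not> heavy t G {u, v} \<longrightarrow> (\<forall>e\<in>edges G. {u, v} \<subseteq> e \<longrightarrow> e \<inter> X \<noteq> {}))" for u v
  proof (cases "heavy t G {u, v}")
    case True
    then show ?thesis by (intro exI[of _ "{}"]) simp
  next
    case False
    then obtain X where "X \<subseteq> verts G - {u, v}" "card X \<le> t"
      "\<not> (\<exists>e\<in>edges G. {u, v} \<subseteq> e \<and> e \<inter> X = {})"
      unfolding heavy_def not_all not_imp by (elim exE conjE)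
    then show ?thesis by (intro exI[of _ X]) (simp add: V_def)
  qed
  define X where "X = (\<lambda>u v. SOME X. X \<subseteq> V - {u, v} \<and> card X \<le> t \<and>
      (\<not> heavy t G {u, v} \<longrightarrow> (\<forall>e\<in>edges G. {u, v} \<subseteq> e \<longrightarrow> e \<inter> X \<noteq> {})))"
  have "X u v \<subseteq> V - {u, v} \<and> card (X u v) \<le> t \<and>
      (\<not> heavy t G {u, v} \<longrightarrow> (\<forall>e\<in>edges G. {u, v} \<subseteq> e \<longrightarrow> e \<inter> X u v \<noteq> {}))" for u v
    unfolding X_def by (rule someI_ex[OF ex])
  then have X: "X u v \<subseteq> V - {u, v}" "card (X u v) \<le> t"
    "\<not> heavy t G {u, v} \<Longrightarrow> e \<in> edges G \<Longrightarrow> {u, v} \<subseteq> e \<Longrightarrow> e \<inter> X u v \<noteq> {}" for u v e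
    by simp_all
  have fX: "finite (X u v)" for u v using X(1)[of u v] V by (auto dest: finite_subset)
  let ?T = "\<lambda>u v x. {W. W \<subseteq> V \<and> card W = s \<and> {u, v, x} \<subseteq> W}"
  let ?L = "complete_sets r G s - cliques V (\<lambda>u v. heavy t G {u, v}) s"
  have sub: "?L \<subseteq> (\<Union>u\<in>V. \<Union>v\<in>V - {u}. \<Union>x\<in>X u v. ?T u v x)"
  proof
    fix W assume W: "W \<in> ?L"
    then have WV: "W \<subseteq> V" and cW: "card W = s"
      and comp: "\<And>e. e \<subseteq> W \<Longrightarrow> card e = r \<Longrightarrow> e \<in> edges G"
      by (auto simp: complete_sets_def V_def)
    have fW: "finite W" using WV V by (rule finite_subset)
    obtain u v where uv: "u \<in> W" "v \<in> W" "u \<noteq> v" "\<not> heavy t G {u, v}"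
      using W WV cW by (auto simp: cliques_def)
    \<comment> \<open>Since \<open>W\<close> is complete, any \<open>r\<close>-subset of
      \<open>W\<close> through \<open>u\<close> and \<open>v\<close> is a hyperedge and meets the
      blocking set \<open>X u v\<close>. That set avoids \<open>u\<close> and \<open>v\<close>, so
      the common vertex is a third vertex of \<open>W\<close>.\<close>
    have "r - 2 \<le> card (W - {u, v})"
      using uv fW cW s by (simp add: card_Diff_subset)
    then obtain Z where Z: "Z \<subseteq> W - {u, v}" "card Z = r - 2" "finite Z"
      by (rule obtain_subset_with_card_n)
    have "card (Z \<union> {u, v}) = r"
      using Z uv r by (subst card_Un_disjoint) auto
    moreover have "Z \<union> {u, v} \<subseteq> W" using Z uv by auto
    ultimately have "Z \<union> {u, v} \<in> edges G" by (intro comp)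
    then obtain x where x: "x \<in> X u v" "x \<in> Z \<union> {u, v}"
      using X(3)[OF uv(4)] by blast
    have "W \<in> ?T u v x" using x Z uv WV cW by auto
    then show "W \<in> (\<Union>u\<in>V. \<Union>v\<in>V - {u}. \<Union>x\<in>X u v. ?T u v x)"
      using uv x(1) WV by blast
  qed
  have T: "card (?T u v x) \<le> card V ^ (s - 3)" if "v \<in> V - {u}" "x \<in> X u v" for u v x
  proof -
    have "x \<noteq> u" "x \<noteq> v" using X(1)[of u v] that by auto
    then have "card {u, v, x} = 3" using that by auto
    then show ?thesis using card_supersets_le[OF V, of "{u, v, x}" s] by simp
  qed
  have "card ?L \<le> card (\<Union>u\<in>V. \<Union>v\<in>V - {u}. \<Union>x\<in>X u v. ?T u v x)"
    using sub V fX by (intro card_mono) auto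
  also have "\<dots> \<le> (\<Sum>u\<in>V. card (\<Union>v\<in>V - {u}. \<Union>x\<in>X u v. ?T u v x))"
    by (rule card_UN_le[OF V])
  also have "\<dots> \<le> (\<Sum>u\<in>V. \<Sum>v\<in>V - {u}. card (\<Union>x\<in>X u v. ?T u v x))"
    using V by (intro sum_mono card_UN_le) auto
  also have "\<dots> \<le> (\<Sum>u\<in>V. \<Sum>v\<in>V - {u}. \<Sum>x\<in>X u v. card (?T u v x))"
    by (intro sum_mono card_UN_le fX)
  also have "\<dots> \<le> (\<Sum>u\<in>V. \<Sum>v\<in>V - {u}. \<Sum>x\<in>X u v. card V ^ (s - 3))"
    by (intro sum_mono T)
  also have "\<dots> \<le> (\<Sum>u\<in>V. \<Sum>v\<in>V - {u}. t * card V ^ (s - 3))"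
    using X(2) by (intro sum_mono) simp
  also have "\<dots> \<le> (\<Sum>u\<in>V. \<Sum>v\<in>V. t * card V ^ (s - 3))"
    using V by (intro sum_mono sum_mono2) auto
  also have "\<dots> = t * (card V ^ 2 * card V ^ (s - 3))"
    by (simp add: power2_eq_square)
  also have "card V ^ 2 * card V ^ (s - 3) = card V ^ (s - 1)"
  proof -
    have "2 + (s - 3) = s - 1" using r s by simp
    then show ?thesis by (metis power_add)
  qed
  finally show ?thesis by (simp add: V_def)
qed

text \<open>Greedy choice: if no clique avoids the union of the disjoint cliques found so far, that
  union is itself a small hitting set.\<close>

lemma disjoint_cliques_or_hitting_set:
  assumes V: "finite V"
  shows "(\<exists>Q. (\<forall>i<k. Q i \<in> cliques V R m) \<and> disjoint_family_on Q {..<k}) \<or>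
         (\<exists>D. D \<subseteq> V \<and> card D \<le> k * m \<and> cliques (V - D) R m = {})"
proof (induction k)
  case 0
  then show ?case by (simp add: disjoint_family_on_def)
next
  case (Suc k)
  from Suc.IH show ?case
  proof
    assume "\<exists>D. D \<subseteq> V \<and> card D \<le> k * m \<and> cliques (V - D) R m = {}"
    then show ?thesis by (metis le_add2 mult_Suc order_trans)
  next
    assume "\<exists>Q. (\<forall>i<k. Q i \<in> cliques V R m) \<and> disjoint_family_on Q {..<k}"
    then obtain Q where Q: "\<And>i. i < k \<Longrightarrow> Q i \<in> cliques V R m" "disjoint_family_on Q {..<k}"
      by blast
    define D where "D = (\<Union>i<k. Q i)"
    have DV: "D \<subseteq> V" using Q(1) unfolding D_def cliques_def by blast
    show ?thesis
    proof (cases "cliques (V - D) R m = {}")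
      case True
      have "card D \<le> (\<Sum>i<k. card (Q i))" unfolding D_def by (rule card_UN_le) simp
      also have "\<dots> = (\<Sum>i<k. m)"
        by (rule sum.cong[OF refl]) (simp add: clique_cardD[OF Q(1)])
      also have "\<dots> = k * m" by simp
      finally have "card D \<le> Suc k * m" by simp
      then show ?thesis using True DV by blast
    next
      case False
      then obtain A where A: "A \<in> cliques (V - D) R m" by blast
      then have AV: "A \<in> cliques V R m" and AD: "A \<inter> D = {}" by (auto simp: cliques_def)
      have "(Q(k := A)) i \<in> cliques V R m" if "i < Suc k" for i
        using Q(1) AV that by auto
      moreover have "disjoint_family_on (Q(k := A)) {..<Suc k}"
      proof -
        have AQ: "A \<inter> Q i = {}" if "i < k" for i using AD that unfolding D_def by blast
        have "Q i \<inter> Q j = {}" if "i < k" "j < k" "i \<noteq> j" for i j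
          using Q(2) that by (simp add: disjoint_family_on_def)
        then show ?thesis
          using AQ by (simp add: disjoint_family_on_def lessThan_Suc Int_commute)
      qed
      ultimately show ?thesis by blast
    qed
  qed
qed

text \<open>The pairs are expanded one at a time. The set \<open>Q\<close> and the hyperedges chosen
  earlier cover at most \<open>card Q + r * card P\<close> vertices, so heaviness yields a hyperedge
  that meets them only in the current pair.\<close>

lemma expand_heavy_pairs:
  assumes G: "r_graph r G" and P: "finite P" and Q: "Q \<subseteq> verts G"
    and pr: "\<And>p. p \<in> P \<Longrightarrow> pr p \<subseteq> Q" and hv: "\<And>p. p \<in> P \<Longrightarrow> heavy t G (pr p)"
    and t: "card Q + r * card P \<le> t"
  shows "\<exists>E. \<forall>p\<in>P. E p \<in> edges G \<and> E p \<inter> Q = pr p \<and> (\<forall>q\<in>P. p \<noteq> q \<longrightarrow> E p \<inter> E q \<subseteq> Q)"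
  using P pr hv t
proof (induction P rule: finite_induct)
  case empty
  then show ?case by simp
next
  case (insert p P)
  have V: "finite (verts G)" using G by (simp add: r_graph_def)
  obtain E where E: "\<And>p. p \<in> P \<Longrightarrow> E p \<in> edges G" "\<And>p. p \<in> P \<Longrightarrow> E p \<inter> Q = pr p"
    "\<And>p q. p \<in> P \<Longrightarrow> q \<in> P \<Longrightarrow> p \<noteq> q \<Longrightarrow> E p \<inter> E q \<subseteq> Q"
  proof -
    have "card Q + r * card P \<le> t" using insert.prems(3) insert.hyps by (simp add: algebra_simps)
    then show ?thesis using that insert.IH insert.prems(1,2) by (metis insertI2)
  qed
  \<comment> \<open>All vertices to be avoided; the current pair is removed because heaviness only
    concerns sets disjoint from it.\<close>
  define X where "X = (Q \<union> (\<Union>q\<in>P. E q)) - pr p"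
  have EV: "E q \<subseteq> verts G" "card (E q) = r" if "q \<in> P" for q
    using E(1)[OF that] G by (auto simp: r_graph_def)
  have fQE: "finite (Q \<union> (\<Union>q\<in>P. E q))"
    using Q EV V by (meson UN_least Un_least finite_subset)
  have "card X \<le> card (Q \<union> (\<Union>q\<in>P. E q))"
    unfolding X_def by (rule card_mono[OF fQE]) auto
  also have "\<dots> \<le> card Q + card (\<Union>q\<in>P. E q)" by (rule card_Un_le)
  also have "\<dots> \<le> card Q + (\<Sum>q\<in>P. card (E q))"
    using card_UN_le[OF insert.hyps(1), of E] by simp
  also have "\<dots> = card Q + r * card P" using EV(2) by simp
  also have "\<dots> \<le> t" using insert.prems(3) insert.hyps by (simp add: algebra_simps)
  finally have "card X \<le> t" .
  moreover have "X \<subseteq> verts G - pr p" using Q EV(1) by (auto simp: X_def)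
  ultimately obtain e where e: "e \<in> edges G" "pr p \<subseteq> e" "e \<inter> X = {}"
    using insert.prems(2)[of p] unfolding heavy_def by blast
  have eQ: "e \<inter> Q = pr p" using e insert.prems(1)[of p] by (auto simp: X_def)
  have eE: "e \<inter> E q \<subseteq> Q" if "q \<in> P" for q
    using e(3) that insert.prems(1)[of p] by (auto simp: X_def)
  show ?case
  proof (intro exI[of _ "E(p := e)"] ballI conjI impI)
    fix a assume a: "a \<in> insert p P"
    show "(E(p := e)) a \<in> edges G" using a E(1) e(1) by auto
    show "(E(p := e)) a \<inter> Q = pr a" using a E(2) eQ by auto
    fix b assume b: "b \<in> insert p P" and ne: "a \<noteq> b"
    show "(E(p := e)) a \<inter> (E(p := e)) b \<subseteq> Q"
    proof (cases "a = p \<or> b = p")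
      case True
      then show ?thesis using a b ne eE[of a] eE[of b] by (elim disjE) (simp_all add: Int_commute)
    next
      case False
      then show ?thesis using a b ne E(3)[of a b] by simp
    qed
  qed
qed

section \<open>The upper bound\<close>

text \<open>The cliques serve as the old vertices, and expanding their pairs supplies the new ones.
  The bound on \<open>t\<close> allows for \<open>k * m\<close> old vertices and for
  \<open>k * (m choose 2)\<close> hyperedges of size \<open>r\<close>.\<close>

lemma copy_of_expansions_of_heavy_cliques:
  fixes G :: "'a hgraph"
  assumes G: "r_graph r G" and r: "2 \<le> r"
    and Q: "\<And>i. i < k \<Longrightarrow> Q i \<in> cliques (verts G) (\<lambda>u v. heavy t G {u, v}) m"
    and dis: "disjoint_family_on Q {..<k}"
    and t: "k * m + r * (k * (m choose 2)) \<le> t"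
  shows "copies (disjoint_copies k (expansion r (complete_hgraph 2 m))) G \<noteq> {}"
proof -
  let ?F = "disjoint_copies k (expansion r (complete_hgraph 2 m))"
  have V: "finite (verts G)" using G by (simp add: r_graph_def)
  define D where "D = (\<Union>i<k. Q i)"
  have QV: "Q i \<subseteq> verts G" "card (Q i) = m" "finite (Q i)" if "i < k" for i
    using Q[OF that] V clique_finite[OF V Q[OF that]] by (simp_all add: cliques_def)
  have DV: "D \<subseteq> verts G" using QV(1) by (auto simp: D_def)
  have "card D \<le> (\<Sum>i<k. card (Q i))" unfolding D_def by (rule card_UN_le) simp
  also have "\<dots> = (\<Sum>i<k. m)" by (rule sum.cong[OF refl]) (simp add: QV(2))
  finally have cD: "card D \<le> k * m" by simp
  have "\<exists>h. bij_betw h {..<m} (Q i)" if "i < k" for i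
    using ex_bij_betw_nat_finite[OF QV(3)[OF that]] unfolding QV(2)[OF that] atLeast0LessThan .
  then obtain h where h: "\<And>i. i < k \<Longrightarrow> bij_betw (h i) {..<m} (Q i)" by metis
  define B where "B = {e. e \<subseteq> {..<m} \<and> card e = 2}"
  \<comment> \<open>\<open>P\<close> indexes the hyperedges of the forbidden hypergraph by copy and
    graph edge; \<open>pr\<close> maps an index to the corresponding pair in a heavy clique.\<close>
  define P where "P = {..<k} \<times> B"
  define pr where "pr = (\<lambda>(i, e). h i ` e)"
  have fB: "finite B" by (simp add: B_def)
  have cP: "card P = k * (m choose 2)"
    by (simp add: P_def B_def card_cartesian_product n_subsets)
  have hQ: "h i a \<in> Q i" if "i < k" "a < m" for i a
    using h[OF that(1)] that(2) by (auto dest: bij_betwE)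
  have h_inj: "a = b" if "h i a = h i b" "i < k" "a < m" "b < m" for i a b
    using h[OF that(2)] that by (auto simp: bij_betw_def dest: inj_onD)
  have prD: "pr p \<subseteq> D" if "p \<in> P" for p
    using that hQ by (fastforce simp: P_def B_def pr_def D_def)
  have pr2: "card (pr p) = 2" if p: "p \<in> P" for p
  proof -
    obtain i e where ie: "p = (i, e)" "i < k" "e \<subseteq> {..<m}" "card e = 2"
      using p by (auto simp: P_def B_def)
    have "card (h i ` e) = card e"
      by (rule card_image[OF inj_on_subset[OF bij_betw_imp_inj_on[OF h[OF ie(2)]] ie(3)]])
    then show ?thesis using ie by (simp add: pr_def)
  qed
  have hv: "heavy t G (pr p)" if p: "p \<in> P" for p
  proof -
    obtain i e where ie: "p = (i, e)" "i < k" "e \<subseteq> {..<m}" "card e = 2"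
      using p by (auto simp: P_def B_def)
    obtain a b where ab: "e = {a, b}" "a \<noteq> b" using ie(4) by (meson card_2_iff)
    have "h i a \<noteq> h i b" using h_inj[of i a b] ab ie by auto
    then have "heavy t G {h i a, h i b}"
      using cliqueD[OF Q[OF ie(2)] hQ[of i a] hQ[of i b]] ab ie by auto
    then show ?thesis by (simp add: pr_def ie(1) ab(1))
  qed
  have tP: "card D + r * card P \<le> t" using cD cP t by simp
  have fP: "finite P" using fB by (simp add: P_def)
  obtain E where "\<forall>p\<in>P. E p \<in> edges G \<and> E p \<inter> D = pr p \<and> (\<forall>q\<in>P. p \<noteq> q \<longrightarrow> E p \<inter> E q \<subseteq> D)"
    using expand_heavy_pairs[where P = P and pr = pr and Q = D, OF G fP DV prD hv tP] ..
  then have E: "\<And>p. p \<in> P \<Longrightarrow> E p \<in> edges G" "\<And>p. p \<in> P \<Longrightarrow> E p \<inter> D = pr p"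
    "\<And>p q. p \<in> P \<Longrightarrow> q \<in> P \<Longrightarrow> p \<noteq> q \<Longrightarrow> E p \<inter> E q \<subseteq> D"
    by simp_all
  have EV: "E p \<subseteq> verts G" "card (E p) = r" if "p \<in> P" for p
    using E(1)[OF that] G by (auto simp: r_graph_def)
  have fE: "finite (E p)" if "p \<in> P" for p
    using EV(1)[OF that] V by (rule finite_subset)
  have cE: "card (E p - D) = r - 2" if "p \<in> P" for p
  proof -
    have "card (E p - D) = card (E p) - card (E p \<inter> D)"
      using fE[OF that] by (intro card_Diff_subset_Int) simp
    then show ?thesis using E(2) EV(2) pr2 that by simp
  qed
  have "\<exists>g. bij_betw g {..<r - 2} (E p - D)" if "p \<in> P" for p
    using ex_bij_betw_nat_finite[of "E p - D"] fE[OF that]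
    unfolding cE[OF that] atLeast0LessThan by simp
  then obtain g where g: "\<And>p. p \<in> P \<Longrightarrow> bij_betw (g p) {..<r - 2} (E p - D)" by metis
  have gE: "g p j \<in> E p" "g p j \<notin> D" if "p \<in> P" "j < r - 2" for p j
    using bij_betwE[OF g[OF that(1)]] that(2) by auto
  \<comment> \<open>The embedding: the old vertex \<open>a\<close> of copy \<open>i\<close> goes to
    the \<open>a\<close>-th vertex of \<open>Q i\<close>, and the \<open>j\<close>-th new vertex of
    the edge \<open>e\<close> goes to the \<open>j\<close>-th vertex of \<open>E (i, e)\<close>
    outside \<open>D\<close>.\<close>
  define f where "f = (\<lambda>(i, x). case x of Inl a \<Rightarrow> h i a | Inr (e, j) \<Rightarrow> g (i, e) j)"
  have vF: "verts ?F = {..<k} \<times> (Inl ` {..<m} \<union> Inr ` (B \<times> {..<r - 2}))"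
    by (simp add: disjoint_copies_def expansion_def complete_hgraph_def B_def)
  have eF: "\<exists>i e. i < k \<and> e \<in> B \<and> x = Pair i ` (Inl ` e \<union> Inr ` ({e} \<times> {..<r - 2}))"
    if "x \<in> edges ?F" for x
    using that by (auto simp: disjoint_copies_def expansion_def complete_hgraph_def B_def)
  have inD: "f (i, Inl a) \<in> D" if "i < k" "a < m" for i a
    using hQ[OF that] that(1) by (auto simp: f_def D_def)
  have inj: "inj_on f (verts ?F)"
  proof (rule inj_onI)
    fix x y assume x: "x \<in> verts ?F" and y: "y \<in> verts ?F" and eq: "f x = f y"
    obtain i x' where x': "x = (i, x')" "i < k" "x' \<in> Inl ` {..<m} \<union> Inr ` (B \<times> {..<r - 2})"
      using x unfolding vF by auto
    obtain i2 y' where y': "y = (i2, y')" "i2 < k" "y' \<in> Inl ` {..<m} \<union> Inr ` (B \<times> {..<r - 2})"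
      using y unfolding vF by auto
    \<comment> \<open>Old vertices of different copies are separated by disjointness of the cliques,
      old from new ones by membership in \<open>D\<close>, and new vertices of different edges
      because their hyperedges meet only inside \<open>D\<close>.\<close>
    consider (ll) a b where "x' = Inl a" "y' = Inl b" "a < m" "b < m"
      | (lr) a e j where "x' = Inl a" "y' = Inr (e, j)" "a < m" "e \<in> B" "j < r - 2"
      | (rl) a e j where "x' = Inr (e, j)" "y' = Inl a" "a < m" "e \<in> B" "j < r - 2"
      | (rr) e j e2 j2 where "x' = Inr (e, j)" "y' = Inr (e2, j2)" "e \<in> B" "j < r - 2"
          "e2 \<in> B" "j2 < r - 2"
      using x'(3) y'(3) by auto
    then show "x = y"
    proof cases
      case ll
      have heq: "h i a = h i2 b" using eq x' y' ll by (simp add: f_def)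
      have "h i a \<in> Q i" "h i a \<in> Q i2" using hQ[of i a] hQ[of i2 b] heq x' y' ll by auto
      then have "i = i2" using dis x'(2) y'(2) by (auto simp: disjoint_family_on_def)
      then show ?thesis using h_inj[of i a b] heq x' y' ll by simp
    next
      case lr
      then show ?thesis
        using eq x' y' inD[of i a] gE(2)[of "(i2, e)" j] by (simp add: f_def P_def)
    next
      case rl
      then show ?thesis
        using eq x' y' inD[of i2 a] gE(2)[of "(i, e)" j] by (simp add: f_def P_def)
    next
      case rr
      have P: "(i, e) \<in> P" "(i2, e2) \<in> P" using rr x' y' by (auto simp: P_def)
      have geq: "g (i, e) j = g (i2, e2) j2" using eq x' y' rr by (simp add: f_def)
      have pq: "(i, e) = (i2, e2)"
        using E(3)[OF P] gE[OF P(1) rr(4)] gE[OF P(2) rr(6)] geq by auto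
      then have "j = j2"
        using bij_betw_imp_inj_on[OF g[OF P(1)]] geq rr by (auto dest: inj_onD)
      then show ?thesis using pq x' y' rr by simp
    qed
  qed
  define H where "H = (f ` verts ?F, (\<lambda>e. f ` e) ` edges ?F)"
  have "f x \<in> verts G" if x: "x \<in> verts ?F" for x
  proof -
    obtain i x' where x': "x = (i, x')" "i < k" "x' \<in> Inl ` {..<m} \<union> Inr ` (B \<times> {..<r - 2})"
      using x unfolding vF by auto
    consider (l) a where "x' = Inl a" "a < m" | (r) e j where "x' = Inr (e, j)" "e \<in> B" "j < r - 2"
      using x'(3) by auto
    then show ?thesis
    proof cases
      case l
      then show ?thesis using inD[of i a] x' DV by auto
    next
      case r
      then have "(i, e) \<in> P" using x' by (simp add: P_def)
      then have "g (i, e) j \<in> verts G" using gE(1)[of "(i, e)" j] EV(1)[of "(i, e)"] r by auto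
      then show ?thesis using r x' by (simp add: f_def)
    qed
  qed
  then have "verts H \<subseteq> verts G" by (auto simp: H_def)
  moreover have "f ` x \<in> edges G" if x: "x \<in> edges ?F" for x
  proof -
    obtain i e where ie: "i < k" "e \<in> B" and xe: "x = Pair i ` (Inl ` e \<union> Inr ` ({e} \<times> {..<r - 2}))"
      using eF[OF x] by blast
    have P: "(i, e) \<in> P" using ie by (simp add: P_def)
    have "f ` x = h i ` e \<union> g (i, e) ` {..<r - 2}"
    proof -
      have "{e} \<times> {..<r - 2} = Pair e ` {..<r - 2}" by auto
      then show ?thesis unfolding xe by (simp add: f_def image_Un image_image)
    qed
    also have "h i ` e = E (i, e) \<inter> D" using E(2)[OF P] by (simp add: pr_def)
    also have "g (i, e) ` {..<r - 2} = E (i, e) - D" by (rule bij_betw_imp_surj_on[OF g[OF P]])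
    also have "E (i, e) \<inter> D \<union> (E (i, e) - D) = E (i, e)" by blast
    finally show ?thesis using E(1)[OF P] by simp
  qed
  then have "edges H \<subseteq> edges G" by (auto simp: H_def)
  moreover have "hgraph_iso ?F H"
    unfolding hgraph_iso_def H_def using inj by (intro exI[of _ f]) (simp add: bij_betw_def)
  ultimately have "H \<in> copies ?F G" by (simp add: copies_def)
  then show ?thesis by blast
qed

text \<open>A complete \<open>s\<close>-set contains a light pair, or meets the hitting set
  \<open>D\<close>, or is a clique of heavy pairs outside \<open>D\<close>. The first two kinds
  contribute the error term, and Zykov's bound applies to the third.\<close>

theorem num_copies_complete_le:
  fixes k l r s :: nat
  defines "t \<equiv> k * Suc l + r * (k * (Suc l choose 2))"
  assumes G: "r_graph r G" and r: "3 \<le> r" and s: "r \<le> s" and l: "s \<le> l"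
    and free: "copies (disjoint_copies k (expansion r (complete_hgraph 2 (Suc l)))) G = {}"
  shows "real (num_copies (complete_hgraph r s) G) \<le>
         real (l choose s) * (real (card (verts G)) / real l) ^ s
         + real (t + k * Suc l) * real (card (verts G)) ^ (s - 1)"
proof -
  define V where "V = verts G"
  define R where "R = (\<lambda>u v. heavy t G {u, v})"
  have V: "finite V" using G by (simp add: r_graph_def V_def)
  have "\<not> (\<exists>Q. (\<forall>i<k. Q i \<in> cliques V R (Suc l)) \<and> disjoint_family_on Q {..<k})"
    using copy_of_expansions_of_heavy_cliques[OF G, of k _ t "Suc l"] r free
    unfolding V_def R_def t_def by auto
  then obtain D where D: "D \<subseteq> V" "card D \<le> k * Suc l" "cliques (V - D) R (Suc l) = {}"
    using disjoint_cliques_or_hitting_set[OF V, of k R "Suc l"] by blast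
  have fD: "finite D" using D(1) V by (rule finite_subset)
  let ?T = "\<lambda>d. {W. W \<subseteq> V \<and> card W = s \<and> {d} \<subseteq> W}"
  let ?L = "complete_sets r G s - cliques V R s"
  have "complete_sets r G s \<subseteq> ?L \<union> (cliques (V - D) R s \<union> (\<Union>d\<in>D. ?T d))"
    by (auto simp: cliques_def)
  moreover have "finite (?L \<union> (cliques (V - D) R s \<union> (\<Union>d\<in>D. ?T d)))"
    using V fD finite_complete_sets[of G r s] finite_cliques[of "V - D" R s]
    by (simp add: V_def)
  ultimately have "card (complete_sets r G s) \<le>
      card (?L \<union> (cliques (V - D) R s \<union> (\<Union>d\<in>D. ?T d)))"
    by (intro card_mono)
  also have "\<dots> \<le> card ?L + (card (cliques (V - D) R s) + card (\<Union>d\<in>D. ?T d))"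
    by (meson add_left_mono card_Un_le order_trans)
  also have "card ?L \<le> t * card V ^ (s - 1)"
    unfolding V_def R_def by (rule card_complete_sets_light_le[OF G r s])
  also have "card (\<Union>d\<in>D. ?T d) \<le> k * Suc l * card V ^ (s - 1)"
  proof -
    have "card (\<Union>d\<in>D. ?T d) \<le> (\<Sum>d\<in>D. card (?T d))" by (rule card_UN_le[OF fD])
    also have "\<dots> \<le> (\<Sum>d\<in>D. card V ^ (s - 1))"
    proof (rule sum_mono)
      fix d
      show "card (?T d) \<le> card V ^ (s - 1)" using card_supersets_le[OF V, of "{d}" s] by simp
    qed
    also have "\<dots> \<le> k * Suc l * card V ^ (s - 1)" using D(2) by simp
    finally show ?thesis .
  qed
  finally have "card (complete_sets r G s) \<le>
      card (cliques (V - D) R s) + (t + k * Suc l) * card V ^ (s - 1)"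
    by (simp add: algebra_simps)
  then have "real (card (complete_sets r G s)) \<le>
      real (card (cliques (V - D) R s) + (t + k * Suc l) * card V ^ (s - 1))"
    by (simp only: of_nat_le_iff)
  also have "\<dots> = real (card (cliques (V - D) R s)) + real (t + k * Suc l) * real (card V) ^ (s - 1)"
    by simp
  also have "real (card (cliques (V - D) R s)) \<le> real (l choose s) * (real (card (V - D)) / real l) ^ s"
    using V r s l by (intro Zykov D(3)) auto
  also have "\<dots> \<le> real (l choose s) * (real (card V) / real l) ^ s"
    using V by (intro mult_left_mono power_mono divide_right_mono) (auto intro: card_mono)
  finally show ?thesis
    using V by (simp add: num_copies_complete V_def)
qed

section \<open>The extremal construction\<close>

text \<open>Each expanded clique needs a vertex among the \<open>t\<close> special ones, since
  otherwise two of its \<open>l + 1\<close> old vertices share a part and the hyperedge through them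
  is missing. Disjointness then requires \<open>k\<close> special vertices, but
  \<open>t < k\<close>.\<close>

lemma joined_partite_expansion_free:
  assumes l: "0 < l" and n: "t \<le> n" and k: "t < k"
  shows "copies (disjoint_copies k (expansion r (complete_hgraph 2 (Suc l)))) (joined_partite r n t l) = {}"
proof (rule ccontr)
  let ?F = "disjoint_copies k (expansion r (complete_hgraph 2 (Suc l)))"
  let ?J = "joined_partite r n t l"
  assume "copies ?F ?J \<noteq> {}"
  then obtain H f where HV: "verts H \<subseteq> verts ?J" and HE: "edges H \<subseteq> edges ?J"
    and f: "bij_betw f (verts ?F) (verts H)" and fE: "edges H = (\<lambda>e. f ` e) ` edges ?F"
    by (auto simp: copies_def hgraph_iso_def)
  have inj: "inj_on f (verts ?F)" using f by (rule bij_betw_imp_inj_on)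
  have fV: "f x < n" if "x \<in> verts ?F" for x
  proof -
    have "f x \<in> verts ?J" using bij_betwE[OF f] that HV by blast
    then show ?thesis by (simp add: joined_partite_def)
  qed
  have core: "(i, Inl a) \<in> verts ?F" if "i < k" "a < Suc l" for i a
    using that by (auto simp: disjoint_copies_def expansion_def complete_hgraph_def)
  have "\<exists>x. (i, x) \<in> verts ?F \<and> f (i, x) \<in> {n - t..<n}" if i: "i < k" for i
  proof (rule ccontr)
    assume "\<not> ?thesis"
    then have out: "f (i, x) \<notin> {n - t..<n}" if "(i, x) \<in> verts ?F" for x using that by blast
    have "\<not> inj_on (\<lambda>a. f (i, Inl a) mod l) {..<Suc l}"
    proof
      assume "inj_on (\<lambda>a. f (i, Inl a) mod l) {..<Suc l}"
      then have "card {..<Suc l} \<le> card {..<l}"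
        using l by (intro card_inj_on_le[of _ _ "{..<l}"]) auto
      then show False by simp
    qed
    then obtain a b where ab: "a < Suc l" "b < Suc l" "a \<noteq> b"
      "f (i, Inl a) mod l = f (i, Inl b) mod l"
      by (auto simp: inj_on_def)
    \<comment> \<open>The hyperedge expanding the graph edge between the two old vertices whose
      images share a residue class.\<close>
    define e where "e = Pair i ` (Inl ` {a, b} \<union> Inr ` ({{a, b}} \<times> {..<r - 2}))"
    have "{a, b} \<in> {e. e \<subseteq> {..<Suc l} \<and> card e = 2}" using ab by auto
    then have eF: "e \<in> edges ?F"
      unfolding disjoint_copies_def expansion_def complete_hgraph_def e_def fst_conv snd_conv
      by (intro CollectI exI[of _ i] conjI i
          exI[of _ "Inl ` {a, b} \<union> Inr ` ({{a, b}} \<times> {..<r - 2})"] refl image_eqI[of _ _ "{a, b}"]) auto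
    have eV: "e \<subseteq> Pair i ` UNIV \<inter> verts ?F"
      using ab i unfolding disjoint_copies_def expansion_def complete_hgraph_def e_def by auto
    have "f ` e \<in> edges ?J" using HE fE eF by auto
    moreover have "f ` e \<inter> {n - t..<n} = {}" using eV out by fastforce
    ultimately have "f ` e \<in> edges (balanced_partite r (n - t) l)"
      by (auto simp: joined_partite_def)
    then have c: "card (f ` e \<inter> {v. v mod l = f (i, Inl a) mod l}) \<le> 1" and fin: "f ` e \<subseteq> {..<n - t}"
      using l by (auto simp: balanced_partite_def)
    have "{f (i, Inl a), f (i, Inl b)} \<subseteq> f ` e \<inter> {v. v mod l = f (i, Inl a) mod l}"
      using ab by (auto simp: e_def)
    then have "card {f (i, Inl a), f (i, Inl b)} \<le> 1"
      using c fin by (meson card_mono finite_Int finite_lessThan finite_subset order_trans)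
    then have "f (i, Inl a) = f (i, Inl b)" by (auto simp: card_insert_if split: if_splits)
    then have "(i, Inl a :: nat + nat set \<times> nat) = (i, Inl b)"
      using inj_onD[OF inj] core[OF i] ab by blast
    then show False using ab by simp
  qed
  then obtain x where x: "\<And>i. i < k \<Longrightarrow> (i, x i) \<in> verts ?F" "\<And>i. i < k \<Longrightarrow> f (i, x i) \<in> {n - t..<n}"
    by metis
  have "inj_on (\<lambda>i. f (i, x i)) {..<k}"
  proof (rule inj_onI)
    fix i j assume "i \<in> {..<k}" "j \<in> {..<k}" "f (i, x i) = f (j, x j)"
    then have "(i, x i) = (j, x j)" using inj_onD[OF inj] x(1) by blast
    then show "i = j" by simp
  qed
  then have "card {..<k} \<le> card {n - t..<n}"
    using x(2) by (intro card_inj_on_le[of _ _ "{n - t..<n}"]) auto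
  then show False using k n by simp
qed

text \<open>Only transversals of the partite piece are counted: \<open>s\<close> of the
  \<open>l\<close> residue classes and one of at least \<open>(n - t) div l\<close> vertices in
  each. This already gives the leading order.\<close>

lemma num_copies_joined_partite_ge:
  assumes l: "0 < l"
  shows "(l choose s) * ((n - t) div l) ^ s \<le> num_copies (complete_hgraph r s) (joined_partite r n t l)"
proof -
  define q where "q = (n - t) div l"
  \<comment> \<open>A transversal is encoded by its residues \<open>J\<close> and the quotients
    \<open>h\<close> on \<open>J\<close>; extensionality of \<open>h\<close> makes the encoding
    unique.\<close>
  define A where "A = (SIGMA J:{J. J \<subseteq> {..<l} \<and> card J = s}. J \<rightarrow>\<^sub>E {..<q})"
  define w where "w = (\<lambda>(J, h :: nat \<Rightarrow> nat). (\<lambda>j. h j * l + j) ` J)"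
  let ?J = "joined_partite r n t l"
  have fJ: "finite J" if "J \<subseteq> {..<l}" for J using that by (rule finite_subset) simp
  have md: "(x * l + j) mod l = j" if "j < l" for x j :: nat using that by simp
  have "card A = (\<Sum>J | J \<subseteq> {..<l} \<and> card J = s. card (J \<rightarrow>\<^sub>E {..<q}))"
    unfolding A_def by (rule card_SigmaI) (auto intro: finite_PiE fJ)
  also have "\<dots> = (\<Sum>J | J \<subseteq> {..<l} \<and> card J = s. q ^ s)"
    by (rule sum.cong[OF refl]) (auto simp: card_PiE fJ)
  also have "\<dots> = (l choose s) * q ^ s" by (simp add: n_subsets)
  finally have cA: "card A = (l choose s) * q ^ s" .
  have "inj_on w A"
  proof (rule inj_onI)
    fix x y assume x: "x \<in> A" and y: "y \<in> A" and eq: "w x = w y"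
    obtain J h where Jh: "x = (J, h)" "J \<subseteq> {..<l}" "h \<in> J \<rightarrow>\<^sub>E {..<q}"
      using x by (auto simp: A_def)
    obtain J' h' where Jh': "y = (J', h')" "J' \<subseteq> {..<l}" "h' \<in> J' \<rightarrow>\<^sub>E {..<q}"
      using y by (auto simp: A_def)
    \<comment> \<open>\<open>J\<close> is recovered from the transversal as its set of
      residues.\<close>
    have res: "(\<lambda>v. v mod l) ` (\<lambda>j. h j * l + j) ` J = J" if "J \<subseteq> {..<l}" for J and h :: "nat \<Rightarrow> nat"
    proof -
      have "(\<lambda>j. (h j * l + j) mod l) ` J = (\<lambda>j. j) ` J"
        using that by (intro image_cong refl md) auto
      then show ?thesis by (simp only: image_image image_ident)
    qed
    have JJ: "J = J'"
      using res[OF Jh(2), of h] res[OF Jh'(2), of h'] eq unfolding Jh(1) Jh'(1) w_def by simp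
    have "h j = h' j" if j: "j \<in> J" for j
    proof -
      have "h j * l + j \<in> (\<lambda>j. h' j * l + j) ` J"
        using eq j unfolding Jh(1) Jh'(1) w_def JJ by auto
      then obtain i where i: "i \<in> J" "h j * l + j = h' i * l + i" by auto
      have "j < l" "i < l" using i(1) j Jh(2) by auto
      then have "j = i" using md[of j "h j"] md[of i "h' i"] i(2) by simp
      then show ?thesis using i(2) l by simp
    qed
    then have "h = h'" using Jh(3) Jh'(3) JJ by (auto intro: PiE_ext)
    then show "x = y" using Jh(1) Jh'(1) JJ by simp
  qed
  moreover have "w ` A \<subseteq> complete_sets r ?J s"
  proof
    fix W assume "W \<in> w ` A"
    then obtain J h where J: "J \<subseteq> {..<l}" "card J = s" and h: "h \<in> J \<rightarrow>\<^sub>E {..<q}"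
      and W: "W = (\<lambda>j. h j * l + j) ` J"
      by (auto simp: A_def w_def)
    have same: "u = v" if uv: "u \<in> W" "v \<in> W" "u mod l = v mod l" for u v
    proof -
      obtain i j where ij: "i \<in> J" "u = h i * l + i" "j \<in> J" "v = h j * l + j"
        using uv(1,2) unfolding W by (elim imageE) (rule that)
      have "i < l" "j < l" using ij J(1) by auto
      then have "i = j" using uv(3) ij md[of i "h i"] md[of j "h j"] by (simp only:)
      then show ?thesis using ij by simp
    qed
    have "inj_on (\<lambda>j. h j * l + j) J"
    proof (rule inj_onI)
      fix i j assume ij: "i \<in> J" "j \<in> J" "h i * l + i = h j * l + j"
      then have "i < l" "j < l" using J(1) by auto
      then show "i = j" using arg_cong[OF ij(3), of "\<lambda>v. v mod l"] by (simp only: md)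
    qed
    then have cW: "card W = s" unfolding W using J(2) by (simp add: card_image)
    have bd: "v < n - t" if v: "v \<in> W" for v
    proof -
      obtain j where j: "j \<in> J" "v = h j * l + j" using v by (auto simp: W)
      have "h j < q" "j < l" using h j(1) J(1) by auto
      then have "v < (h j + 1) * l" using j(2) by simp
      also have "\<dots> \<le> q * l" using \<open>h j < q\<close> by (intro mult_right_mono) auto
      also have "\<dots> \<le> n - t" by (simp add: q_def)
      finally show ?thesis .
    qed
    have fW: "finite W" using bd by (meson bounded_nat_set_is_finite)
    have "e \<in> edges ?J" if e: "e \<subseteq> W" "card e = r" for e
    proof -
      have "card (e \<inter> {v. v mod l = j}) \<le> 1" for j
      proof -
        have "finite (e \<inter> {v. v mod l = j})" using e(1) fW by (meson finite_Int finite_subset)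
        moreover have "u = v" if "u \<in> e \<inter> {v. v mod l = j}" "v \<in> e \<inter> {v. v mod l = j}" for u v
          by (rule same) (use that e(1) in auto)
        ultimately show ?thesis by (simp only: One_nat_def card_le_Suc0_iff_eq) blast
      qed
      then show ?thesis
        using e bd unfolding joined_partite_def balanced_partite_def by auto
    qed
    moreover have "W \<subseteq> verts ?J" using bd by (fastforce simp: joined_partite_def)
    ultimately show "W \<in> complete_sets r ?J s" using cW by (simp add: complete_sets_def)
  qed
  moreover have fin: "finite (verts ?J)" by (simp add: joined_partite_def)
  ultimately have "card A \<le> card (complete_sets r ?J s)"
    by (intro card_inj_on_le finite_complete_sets)
  then show ?thesis using cA fin by (simp add: num_copies_complete q_def)
qed

section \<open>Asymptotics\<close>

lemma asymp_equiv_affine_power: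
  fixes a b c :: real
  assumes a: "a > 0"
  shows "(\<lambda>n. c * ((real n - b) / a) ^ s) \<sim>[at_top] (\<lambda>n. c * (real n / a) ^ s)"
proof -
  have "(\<lambda>n. - b) \<in> o(\<lambda>n. real n)"
    by (rule smalloI_tendsto[OF lim_const_over_n])
       (use eventually_gt_at_top[of 0] in eventually_elim, simp)
  then have "(\<lambda>n. real n + - b) \<sim>[at_top] real"
    by (subst asymp_equiv_add_right) simp_all
  then show ?thesis by (intro asymp_equiv_intros) simp
qed

lemma asymp_equiv_add_lower_power:
  fixes a c d :: real
  assumes a: "a > 0" and c: "c > 0" and s: "s > 0"
  shows "(\<lambda>n. c * (real n / a) ^ s + d * real n ^ (s - 1)) \<sim>[at_top] (\<lambda>n. c * (real n / a) ^ s)"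
proof -
  have "(\<lambda>n. d * real n ^ (s - 1)) \<in> o(\<lambda>n. c * (real n / a) ^ s)"
  proof (rule smalloI_tendsto)
    \<comment> \<open>The quotient of the two terms is a constant over \<open>n\<close>;
      \<open>s > 0\<close> ensures that \<open>s - 1\<close> is really one less than
      \<open>s\<close>.\<close>
    have "(\<lambda>n. (d * a ^ s / c) / real n) \<longlonglongrightarrow> 0" by (rule lim_const_over_n)
    moreover have "\<forall>\<^sub>F n in at_top. (d * a ^ s / c) / real n = d * real n ^ (s - 1) / (c * (real n / a) ^ s)"
      using eventually_gt_at_top[of 0]
    proof eventually_elim
      case (elim n)
      have "real n ^ s = real n * real n ^ (s - 1)" using s by (simp flip: power_Suc)
      then show ?case using elim a c by (simp add: field_simps)
    qed
    ultimately show "(\<lambda>n. d * real n ^ (s - 1) / (c * (real n / a) ^ s)) \<longlonglongrightarrow> 0"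
      by (rule Lim_transform_eventually)
    show "\<forall>\<^sub>F n in at_top. c * (real n / a) ^ s \<noteq> 0"
      using eventually_gt_at_top[of 0] by eventually_elim (use a c in simp)
  qed
  then show ?thesis by (subst asymp_equiv_add_right) simp_all
qed

theorem theorem2p4:
  fixes k l s r :: nat
  assumes "k \<ge> 1" and "l \<ge> s" and "s \<ge> r" and "r \<ge> 3"
  shows "(\<lambda>n. real (ex_count r n (complete_hgraph r s)
                      (disjoint_copies k (expansion r (complete_hgraph 2 (l + 1))))))
         \<sim>[at_top]
         (\<lambda>n. real (num_copies (complete_hgraph r s) (joined_partite r n (k - 1) l)))"
proof -
  let ?F = "disjoint_copies k (expansion r (complete_hgraph 2 (Suc l)))"
  let ?S = "\<lambda>n. {num_copies (complete_hgraph r s) G | G :: nat hgraph.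
            r_graph r G \<and> card (verts G) = n \<and> copies ?F G = {}}"
  let ?f = "\<lambda>n. real (ex_count r n (complete_hgraph r s) ?F)"
  let ?g = "\<lambda>n. real (num_copies (complete_hgraph r s) (joined_partite r n (k - 1) l))"
  \<comment> \<open>The coefficient of the error term in \<open>num_copies_complete_le\<close>: the
    heaviness threshold plus the bound on the size of the hitting set.\<close>
  define C where "C = k * Suc l + r * (k * (Suc l choose 2)) + k * Suc l"
  let ?c = "real (l choose s)"
  \<comment> \<open>The shift \<open>k + l\<close> absorbs the \<open>k - 1\<close> special vertices
    and the loss of less than \<open>l\<close> from rounding in
    \<open>(n - (k - 1)) div l\<close>.\<close>
  let ?lo = "\<lambda>n. ?c * ((real n - real (k + l)) / real l) ^ s"
  let ?mid = "\<lambda>n. ?c * (real n / real l) ^ s"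
  let ?up = "\<lambda>n. ?c * (real n / real l) ^ s + real C * real n ^ (s - 1)"
  have l: "0 < l" and s: "0 < s" and c: "0 < ?c" using assms by auto
  have lo: "?lo \<sim>[at_top] ?mid" using l by (intro asymp_equiv_affine_power) simp
  have up: "?up \<sim>[at_top] ?mid" using l s c by (intro asymp_equiv_add_lower_power) simp_all
  \<comment> \<open>For \<open>n\<close> at least \<open>k + l\<close> the base in
    \<open>?lo\<close> is nonnegative, so taking powers preserves the inequality.\<close>
  have bounds: "?lo n \<le> ?g n \<and> ?g n \<le> ?f n \<and> ?f n \<le> ?up n" if n: "k + l \<le> n" for n
  proof (intro conjI)
    have gS: "num_copies (complete_hgraph r s) (joined_partite r n (k - 1) l) \<in> ?S n"
    proof -
      have "copies ?F (joined_partite r n (k - 1) l) = {}"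
        using l n assms(1) by (intro joined_partite_expansion_free) auto
      moreover have "card (verts (joined_partite r n (k - 1) l)) = n"
        by (simp add: joined_partite_def)
      ultimately show ?thesis using r_graph_joined_partite by blast
    qed
    then show "?g n \<le> ?f n"
      unfolding ex_count_def using ex_count_finite by (intro of_nat_mono Max_ge)
    \<comment> \<open>The extremal construction shows that the set of counts is nonempty, so its
      maximum is attained by some hypergraph \<open>G\<close>, to which the upper bound
      applies.\<close>
    have "ex_count r n (complete_hgraph r s) ?F \<in> ?S n"
      unfolding ex_count_def using gS by (intro Max_in ex_count_finite) blast
    then obtain G :: "nat hgraph" where G: "r_graph r G" "card (verts G) = n" "copies ?F G = {}"
      "ex_count r n (complete_hgraph r s) ?F = num_copies (complete_hgraph r s) G"
      by blast
    show "?f n \<le> ?up n"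
      using num_copies_complete_le[OF G(1) assms(4,3,2) G(3)] unfolding G(2,4) C_def .
    have "n - (k - 1) < ((n - (k - 1)) div l + 1) * l"
      using l by (metis add.commute dividend_less_div_times mult.commute plus_1_eq_Suc mult_Suc)
    then have "real (n - (k - 1)) \<le> real (((n - (k - 1)) div l + 1) * l)"
      by (simp only: of_nat_le_iff less_imp_le)
    then have "real n - real (k + l) \<le> real ((n - (k - 1)) div l) * real l"
      using n assms(1) by (simp add: of_nat_diff algebra_simps)
    then have "(real n - real (k + l)) / real l \<le> real ((n - (k - 1)) div l)"
      using l by (simp add: field_simps)
    then have "?lo n \<le> ?c * real ((n - (k - 1)) div l) ^ s"
      using n by (intro mult_left_mono power_mono) auto
    also have "\<dots> = real ((l choose s) * ((n - (k - 1)) div l) ^ s)" by simp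
    also have "\<dots> \<le> ?g n" by (intro of_nat_mono num_copies_joined_partite_ge l)
    finally show "?lo n \<le> ?g n" .
  qed
  have "?f \<sim>[at_top] ?mid"
    by (rule asymp_equiv_sandwich_real[OF lo up])
       (use eventually_ge_at_top[of "k + l"] in eventually_elim, use bounds in force)
  moreover have "?g \<sim>[at_top] ?mid"
    by (rule asymp_equiv_sandwich_real[OF lo up])
       (use eventually_ge_at_top[of "k + l"] in eventually_elim, use bounds in force)
  ultimately have "?f \<sim>[at_top] ?g"
    using asymp_equiv_trans asymp_equiv_sym by blast
  then show ?thesis by simp
qed

end
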